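(* Let $v: G \rightarrow [0,\infty[$ be a weight on a planar domain $G$ and assume that the space $H^\infty_v(G)$ is normed. The following conditions are equivalent: (i) The space $H^\infty_v(G)$ is a Banach space. (ii) The inclusion map $J: H^\infty_v(G) \rightarrow (H(G),\tau_{co})$ is continuous. (Equivalently, every sequence in $H^\infty_v(G)$ bounded in the norm $\|\cdot\|_v$ is a normal family.) (iii) The closed unit ball $B^\infty_v$ of $H^\infty_v(G)$ is bounded in $(H(G),\tau_{co})$. (iv) For each $z \in G$, the point evaluation functional $\delta_z$ belongs to $H^\infty_v(G)'$ and, moreover, $\sup_{z \in K} \Vert \delta_z \Vert'_v < \infty$ for each compact subset $K$ of $G$.
   Context: A planar domain is a (nonempty) open connected subset $G$ of $\mathbb{C}$. A weight on $G$ is an arbitrary function $v:G\to[0,\infty[$ (not assumed continuous, bounded, or strictly positive). $H(G)$ is the space of holomorphic functions on $G$ and $\tau_{co}$ is the topology of uniform convergence on compact subsets of $G$. $H^\infty_v(G):=\{f\in H(G) : \|f\|_v:=\sup_{z\in G} v(z)|f(z)|<+\infty\}$, endowed with the seminorm $\|\cdot\|_v$. "$H^\infty_v(G)$ is normed" means that $\|\cdot\|_v$ is a norm on $H^\infty_v(G)$. $H^\infty_v(G)'$ is the topological dual of the normed space $H^\infty_v(G)$, with dual norm $\|\cdot\|'_v$, and $\delta_z(f):=f(z)$. A normal family is a family of holomorphic functions on $G$ in which every sequence has a subsequence converging in $(H(G),\tau_{co})$. *)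

theory Defs
  imports "HOL-Analysis.Analysis" "HOL-Library.Function_Algebras"
begin

section \<open>Normed spaces of complex-valued functions\<close>

text \<open>
  Function spaces are subsets of the type \<open>complex \<Rightarrow> complex\<close>, which is a complex vector space
  under the pointwise operations.
\<close>

definition fscale :: "complex \<Rightarrow> (complex \<Rightarrow> complex) \<Rightarrow> (complex \<Rightarrow> complex)" where
  "fscale c f = (\<lambda>z. c * f z)"

interpretation cfun: vector_space fscale
  by unfold_locales (simp_all add: fscale_def fun_eq_iff distrib_left distrib_right mult.assoc)

definition is_norm_on ::
  "(complex \<Rightarrow> complex) set \<Rightarrow> ((complex \<Rightarrow> complex) \<Rightarrow> real) \<Rightarrow> bool" where
  "is_norm_on V N \<longleftrightarrow>
     cfun.subspace V \<and>
     (\<forall>f\<in>V. 0 \<le> N f) \<and>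
     (\<forall>f\<in>V. N f = 0 \<longleftrightarrow> f = 0) \<and>
     (\<forall>c. \<forall>f\<in>V. N (fscale c f) = cmod c * N f) \<and>
     (\<forall>f\<in>V. \<forall>g\<in>V. N (f + g) \<le> N f + N g)"

text \<open>The locale \<open>Metric_space\<close> requires nonnegativity and symmetry of the distance also for
  points outside the carrier, hence the value 0 there.\<close>

definition norm_dist ::
  "(complex \<Rightarrow> complex) set \<Rightarrow> ((complex \<Rightarrow> complex) \<Rightarrow> real) \<Rightarrow>
   (complex \<Rightarrow> complex) \<Rightarrow> (complex \<Rightarrow> complex) \<Rightarrow> real" where
  "norm_dist V N f g = (if f \<in> V \<and> g \<in> V then N (f - g) else 0)"

lemma Metric_space_norm_dist:
  assumes "is_norm_on V N"
  shows "Metric_space V (norm_dist V N)"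
proof -
  have sub: "cfun.subspace V" and nn: "\<And>f. f \<in> V \<Longrightarrow> 0 \<le> N f"
    and z: "\<And>f. f \<in> V \<Longrightarrow> N f = 0 \<longleftrightarrow> f = 0"
    and hom: "\<And>c f. f \<in> V \<Longrightarrow> N (fscale c f) = cmod c * N f"
    and tri: "\<And>f g. f \<in> V \<Longrightarrow> g \<in> V \<Longrightarrow> N (f + g) \<le> N f + N g"
    using assms by (simp_all add: is_norm_on_def)
  have d: "f - g \<in> V" if "f \<in> V" "g \<in> V" for f g
    using cfun.subspace_diff[OF sub that] .
  show ?thesis
  proof
    show "0 \<le> norm_dist V N x y" for x y
      by (simp add: norm_dist_def nn d)
    show "norm_dist V N x y = norm_dist V N y x" for x y
    proof (cases "x \<in> V \<and> y \<in> V")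
      case True
      have "N (fscale (-1) (x - y)) = N (x - y)"
        using hom[of "x - y" "-1"] d True by simp
      moreover have "fscale (-1) (x - y) = y - x"
        by (simp add: fscale_def fun_eq_iff)
      ultimately show ?thesis by (simp add: norm_dist_def)
    qed (auto simp: norm_dist_def)
    show "norm_dist V N x y = 0 \<longleftrightarrow> x = y" if "x \<in> V" "y \<in> V" for x y
      using that z[OF d[OF that]] by (simp add: norm_dist_def)
    show "norm_dist V N x w \<le> norm_dist V N x y + norm_dist V N y w"
      if "x \<in> V" "y \<in> V" "w \<in> V" for x y w
      using tri[OF d[OF that(1,2)] d[OF that(2,3)]] that by (simp add: norm_dist_def)
  qed
qed

definition norm_topology ::
  "(complex \<Rightarrow> complex) set \<Rightarrow> ((complex \<Rightarrow> complex) \<Rightarrow> real) \<Rightarrow> (complex \<Rightarrow> complex) topology" where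
  "norm_topology V N = Metric_space.mtopology V (norm_dist V N)"

definition is_Banach_space ::
  "(complex \<Rightarrow> complex) set \<Rightarrow> ((complex \<Rightarrow> complex) \<Rightarrow> real) \<Rightarrow> bool" where
  "is_Banach_space V N \<longleftrightarrow>
     is_norm_on V N \<and> Metric_space.mcomplete V (norm_dist V N)"

definition closed_unit_ball ::
  "(complex \<Rightarrow> complex) set \<Rightarrow> ((complex \<Rightarrow> complex) \<Rightarrow> real) \<Rightarrow> (complex \<Rightarrow> complex) set" where
  "closed_unit_ball V N = {f \<in> V. N f \<le> 1}"

text \<open>Functionals are HOL functions on the whole type; only their values on \<open>V\<close> matter.\<close>

definition dual_space ::
  "(complex \<Rightarrow> complex) set \<Rightarrow> ((complex \<Rightarrow> complex) \<Rightarrow> real) \<Rightarrow>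
   ((complex \<Rightarrow> complex) \<Rightarrow> complex) set" where
  "dual_space V N = {\<phi>.
     (\<forall>f\<in>V. \<forall>g\<in>V. \<phi> (f + g) = \<phi> f + \<phi> g) \<and>
     (\<forall>c. \<forall>f\<in>V. \<phi> (fscale c f) = c * \<phi> f) \<and>
     continuous_map (norm_topology V N) euclidean \<phi>}"

text \<open>A real-valued supremum, meaningful for functionals in the dual space.\<close>

definition dual_norm ::
  "(complex \<Rightarrow> complex) set \<Rightarrow> ((complex \<Rightarrow> complex) \<Rightarrow> real) \<Rightarrow>
   ((complex \<Rightarrow> complex) \<Rightarrow> complex) \<Rightarrow> real" where
  "dual_norm V N \<phi> = (SUP f\<in>closed_unit_ball V N. cmod (\<phi> f))"

text \<open>Boundedness in a topological vector space of functions: every neighbourhood of 0 absorbs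
  the set.\<close>

definition tvs_bounded :: "(complex \<Rightarrow> complex) topology \<Rightarrow> (complex \<Rightarrow> complex) set \<Rightarrow> bool" where
  "tvs_bounded T B \<longleftrightarrow> B \<subseteq> topspace T \<and>
     (\<forall>U. openin T U \<and> 0 \<in> U \<longrightarrow>
        (\<exists>s>0::real. \<forall>t>s. B \<subseteq> fscale (complex_of_real t) ` U))"


section \<open>Holomorphic functions and the compact-open topology\<close>

text \<open>A function on \<open>G\<close> is represented by its extension by 0 to the complex plane, so that equality
  in the type is equality on \<open>G\<close> and the space is closed under the pointwise operations.\<close>

definition hol_space :: "complex set \<Rightarrow> (complex \<Rightarrow> complex) set" where
  "hol_space G = {f. f holomorphic_on G \<and> (\<forall>z. z \<notin> G \<longrightarrow> f z = 0)}"

definition co_open :: "complex set \<Rightarrow> (complex \<Rightarrow> complex) set \<Rightarrow> bool" where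
  "co_open G U \<longleftrightarrow> U \<subseteq> hol_space G \<and>
     (\<forall>f\<in>U. \<exists>K \<epsilon>. compact K \<and> K \<subseteq> G \<and> 0 < \<epsilon> \<and>
        {g \<in> hol_space G. \<forall>z\<in>K. cmod (g z - f z) < \<epsilon>} \<subseteq> U)"

definition tau_co :: "complex set \<Rightarrow> (complex \<Rightarrow> complex) topology" where
  "tau_co G = topology (co_open G)"

lemma co_openE:
  assumes "co_open G U" "f \<in> U"
  obtains K \<epsilon> where "compact K" "K \<subseteq> G" "0 < \<epsilon>"
    "{g \<in> hol_space G. \<forall>z\<in>K. cmod (g z - f z) < \<epsilon>} \<subseteq> U"
proof -
  have "\<exists>K \<epsilon>. compact K \<and> K \<subseteq> G \<and> 0 < \<epsilon> \<and>
      {g \<in> hol_space G. \<forall>z\<in>K. cmod (g z - f z) < \<epsilon>} \<subseteq> U"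
    using assms(1)[unfolded co_open_def, THEN conjunct2] assms(2) by (rule bspec)
  then show thesis
    by (elim exE conjE) (rule that)
qed

lemma istopology_co_open: "istopology (co_open G)"
  unfolding istopology_def
proof (intro conjI allI impI)
  fix S T assume S: "co_open G S" and T: "co_open G T"
  show "co_open G (S \<inter> T)"
    unfolding co_open_def
  proof (intro conjI ballI)
    show "S \<inter> T \<subseteq> hol_space G" using S[unfolded co_open_def] by (intro le_infI1) (rule conjunct1)
    fix f assume f: "f \<in> S \<inter> T"
    obtain K d where K: "compact K" "K \<subseteq> G" "0 < d"
      "{g \<in> hol_space G. \<forall>z\<in>K. cmod (g z - f z) < d} \<subseteq> S"
      using S IntD1[OF f] by (rule co_openE)
    obtain L e where L: "compact L" "L \<subseteq> G" "0 < e"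
      "{g \<in> hol_space G. \<forall>z\<in>L. cmod (g z - f z) < e} \<subseteq> T"
      using T IntD2[OF f] by (rule co_openE)
    have "{g \<in> hol_space G. \<forall>z\<in>K \<union> L. cmod (g z - f z) < min d e} \<subseteq> S \<inter> T"
      using K(4) L(4) by auto
    then show "\<exists>K \<epsilon>. compact K \<and> K \<subseteq> G \<and> 0 < \<epsilon> \<and>
        {g \<in> hol_space G. \<forall>z\<in>K. cmod (g z - f z) < \<epsilon>} \<subseteq> S \<inter> T"
      using K(1-3) L(1-3) by (intro exI[of _ "K \<union> L"] exI[of _ "min d e"]) (simp add: compact_Un)
  qed
next
  fix \<U> assume *: "\<forall>S\<in>\<U>. co_open G S"
  show "co_open G (\<Union>\<U>)"
    unfolding co_open_def
  proof (intro conjI ballI)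
    show "\<Union>\<U> \<subseteq> hol_space G" using * by (intro Union_least) (simp add: co_open_def)
    fix f assume "f \<in> \<Union>\<U>"
    then obtain S where S: "S \<in> \<U>" "f \<in> S" by (rule UnionE)
    have "co_open G S" using * S(1) by (rule bspec)
    then obtain K e where K: "compact K" "K \<subseteq> G" "0 < e"
      "{g \<in> hol_space G. \<forall>z\<in>K. cmod (g z - f z) < e} \<subseteq> S"
      using S(2) by (rule co_openE)
    have "{g \<in> hol_space G. \<forall>z\<in>K. cmod (g z - f z) < e} \<subseteq> \<Union>\<U>"
      using K(4) Union_upper[OF S(1)] by (rule order_trans)
    then show "\<exists>K \<epsilon>. compact K \<and> K \<subseteq> G \<and> 0 < \<epsilon> \<and>
        {g \<in> hol_space G. \<forall>z\<in>K. cmod (g z - f z) < \<epsilon>} \<subseteq> \<Union>\<U>"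
      using K(1-3) by (intro exI conjI)
  qed
qed

lemma openin_tau_co: "openin (tau_co G) = co_open G"
  by (simp add: tau_co_def istopology_co_open topology_inverse')

lemma topspace_tau_co: "topspace (tau_co G) = hol_space G"
proof
  show "topspace (tau_co G) \<subseteq> hol_space G"
    by (auto simp: topspace_def openin_tau_co co_open_def)
  have "co_open G (hol_space G)"
    unfolding co_open_def by (auto intro!: exI[of _ "{}"] exI[of _ "1::real"])
  then show "hol_space G \<subseteq> topspace (tau_co G)"
    by (simp add: openin_subset openin_tau_co)
qed

definition normal_family :: "complex set \<Rightarrow> (complex \<Rightarrow> complex) set \<Rightarrow> bool" where
  "normal_family G F \<longleftrightarrow> F \<subseteq> hol_space G \<and>
     (\<forall>\<sigma>::nat \<Rightarrow> complex \<Rightarrow> complex. range \<sigma> \<subseteq> F \<longrightarrow>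
        (\<exists>g r. strict_mono (r::nat \<Rightarrow> nat) \<and> limitin (tau_co G) (\<sigma> \<circ> r) g sequentially))"


section \<open>Weighted spaces\<close>

text \<open>The supremum of \<open>v(z) |f(z)|\<close> over \<open>G\<close> as a real number; it is meaningful for \<open>f\<close> in \<open>Hv_space G v\<close>
  and nonempty \<open>G\<close>.\<close>

definition v_norm :: "complex set \<Rightarrow> (complex \<Rightarrow> real) \<Rightarrow> (complex \<Rightarrow> complex) \<Rightarrow> real" where
  "v_norm G v f = (SUP z\<in>G. v z * cmod (f z))"

definition Hv_space :: "complex set \<Rightarrow> (complex \<Rightarrow> real) \<Rightarrow> (complex \<Rightarrow> complex) set" where
  "Hv_space G v = {f \<in> hol_space G. bdd_above ((\<lambda>z. v z * cmod (f z)) ` G)}"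

lemma subspace_Hv_space:
  assumes v: "\<And>z. z \<in> G \<Longrightarrow> 0 \<le> v z"
  shows "cfun.subspace (Hv_space G v)"
proof (rule cfun.subspaceI)
  show "0 \<in> Hv_space G v"
    by (auto simp: Hv_space_def hol_space_def zero_fun_def bdd_above_def)
next
  fix f g assume "f \<in> Hv_space G v" "g \<in> Hv_space G v"
  then obtain A B where fg: "f \<in> hol_space G" "g \<in> hol_space G"
    and A: "\<And>z. z \<in> G \<Longrightarrow> v z * cmod (f z) \<le> A"
    and B: "\<And>z. z \<in> G \<Longrightarrow> v z * cmod (g z) \<le> B"
    by (auto simp: Hv_space_def bdd_above_def)
  have "v z * cmod (f z + g z) \<le> A + B" if "z \<in> G" for z
  proof -
    have "v z * cmod (f z + g z) \<le> v z * (cmod (f z) + cmod (g z))"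
      by (intro mult_left_mono norm_triangle_ineq v that)
    then show ?thesis using A[OF that] B[OF that] by (simp add: distrib_left)
  qed
  moreover have "f + g \<in> hol_space G"
    using fg by (auto simp: hol_space_def plus_fun_def intro: holomorphic_on_add)
  ultimately show "f + g \<in> Hv_space G v"
    by (auto simp: Hv_space_def intro!: bdd_aboveI2)
next
  fix c f assume "f \<in> Hv_space G v"
  then obtain A where f: "f \<in> hol_space G" and A: "\<And>z. z \<in> G \<Longrightarrow> v z * cmod (f z) \<le> A"
    by (auto simp: Hv_space_def bdd_above_def)
  have "v z * cmod (c * f z) \<le> cmod c * A" if "z \<in> G" for z
    using mult_left_mono[OF A[OF that], of "cmod c"] by (simp add: norm_mult mult_ac)
  moreover have "fscale c f \<in> hol_space G"
    using f by (auto simp: hol_space_def fscale_def intro: holomorphic_on_mult)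
  ultimately show "fscale c f \<in> Hv_space G v"
    by (auto simp: Hv_space_def fscale_def intro!: bdd_aboveI2)
qed

end

theory Submission
  imports Defs "HOL-Complex_Analysis.Complex_Analysis"
begin

text \<open>
  Every condition of the theorem is equivalent to a single estimate: for each compact
  \<open>K \<subseteq> G\<close> there is a constant \<open>C\<close> with \<open>\<bar>f z\<bar> \<le> C * N f\<close> for all \<open>z \<in> K\<close> and all \<open>f\<close> in the space
  (\<open>evaluations_locally_bounded\<close>).  Continuity of the inclusion, boundedness of the unit ball and
  the bounds on the dual norms restate this estimate by homogeneity, as in any normed space of
  holomorphic functions.  For normality of bounded sequences, one direction is Montel's theorem;
  conversely, functions of the unit ball that become arbitrarily large on some \<open>K\<close> form a
  sequence without a subsequence converging uniformly on \<open>K\<close>.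

  Completeness depends on the form of the norm.  Given the estimate, a Cauchy sequence for the norm
  is uniformly Cauchy on compact sets, so it has a holomorphic limit \<open>g\<close>, and the weighted bounds
  on the differences survive the passage to \<open>g\<close> (\<open>Hv_space_complete\<close>).

  Completeness gives back the estimate by a closed graph argument
  (\<open>Hv_space_Banach_imp_evaluations_locally_bounded\<close>).  If a sequence converges to \<open>f\<close> in norm
  and to \<open>g\<close> uniformly on compact sets, then \<open>v * \<bar>f - g\<bar> = 0\<close>, hence \<open>f - g\<close> belongs to the space
  and has norm 0, and so \<open>f = g\<close> because the seminorm is a norm.  The
  target of the inclusion is a Frechet space, so the closed graph theorem takes the form of a
  statement about an increasing sequence of seminorms (\<open>Banach_seminorms_bounded\<close>), applied to
  the suprema over a compact exhaustion of \<open>G\<close>.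
\<close>

section \<open>Normed function spaces\<close>

lemma is_norm_onD:
  assumes "is_norm_on V N"
  shows "cfun.subspace V"
    and "f \<in> V \<Longrightarrow> 0 \<le> N f"
    and "f \<in> V \<Longrightarrow> N f = 0 \<longleftrightarrow> f = 0"
    and "f \<in> V \<Longrightarrow> N (fscale c f) = cmod c * N f"
    and "f \<in> V \<Longrightarrow> g \<in> V \<Longrightarrow> N (f + g) \<le> N f + N g"
  using assms by (simp_all add: is_norm_on_def)

lemma norm_on_zero: "is_norm_on V N \<Longrightarrow> N 0 = 0"
  using is_norm_onD(3)[of V N 0] cfun.subspace_0[OF is_norm_onD(1)[of V N]] by simp

lemma norm_on_diff_commute:
  assumes "is_norm_on V N" "f \<in> V" "g \<in> V"
  shows "N (f - g) = N (g - f)"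
proof -
  have "f - g = fscale (- 1) (g - f)"
    by (simp add: fscale_def fun_eq_iff)
  then show ?thesis
    using is_norm_onD(4)[OF assms(1) cfun.subspace_diff[OF is_norm_onD(1)[OF assms(1)] assms(3,2)], of "- 1"]
    by simp
qed

lemma openin_norm_topology:
  assumes "is_norm_on V N"
  shows "openin (norm_topology V N) U \<longleftrightarrow>
    U \<subseteq> V \<and> (\<forall>f\<in>U. \<exists>r>0. \<forall>g\<in>V. N (f - g) < r \<longrightarrow> g \<in> U)"
proof -
  interpret Metric_space V "norm_dist V N"
    using assms by (rule Metric_space_norm_dist)
  have "mball f r \<subseteq> U \<longleftrightarrow> (\<forall>g\<in>V. N (f - g) < r \<longrightarrow> g \<in> U)" if "f \<in> V" for f r
    using that by (auto simp: norm_dist_def)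
  then show ?thesis
    unfolding norm_topology_def openin_mtopology by (metis subsetD)
qed

lemma topspace_norm_topology:
  assumes "is_norm_on V N"
  shows "topspace (norm_topology V N) = V"
  using Metric_space.topspace_mtopology[OF Metric_space_norm_dist[OF assms]]
  by (simp add: norm_topology_def)

lemma norm_topology_zero_nhdE:
  assumes V: "is_norm_on V N" and U: "openin (norm_topology V N) U" "0 \<in> U"
  obtains r where "0 < r" "\<forall>g\<in>V. N g < r \<longrightarrow> g \<in> U"
proof -
  have "\<exists>r>0. \<forall>g\<in>V. N (0 - g) < r \<longrightarrow> g \<in> U"
    using conjunct2[OF U(1)[unfolded openin_norm_topology[OF V]]] U(2) by (rule bspec)
  then obtain r where r: "0 < r" "\<forall>g\<in>V. N (0 - g) < r \<longrightarrow> g \<in> U"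
    by (elim exE conjE)
  have "N (0 - g) = N g" if "g \<in> V" for g
    using norm_on_diff_commute[OF V cfun.subspace_0[OF is_norm_onD(1)[OF V]] that] by simp
  then have "\<forall>g\<in>V. N g < r \<longrightarrow> g \<in> U"
    using r(2) by simp
  then show thesis
    using r(1) by (rule that[rotated])
qed

text \<open>
  The scaling argument behind every passage from a bound near 0 to a bound by a multiple of the
  norm.  The factor 2 comes from rescaling to norm \<open>r / 2\<close>, which lies strictly inside the ball.
\<close>
lemma norm_bound_by_homogeneity:
  assumes V: "is_norm_on V N" and r: "0 < r"
    and small: "\<And>f. f \<in> V \<Longrightarrow> N f < r \<Longrightarrow> p f \<le> c"
    and hom: "\<And>a f. f \<in> V \<Longrightarrow> p (fscale a f) = cmod a * p f"
    and f: "f \<in> V"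
  shows "p f \<le> 2 * c / r * N f"
proof (cases "f = 0")
  case True
  have "fscale 0 f = f"
    using True by (simp add: fscale_def fun_eq_iff)
  then show ?thesis
    using hom[OF f, of 0] norm_on_zero[OF V] True by simp
next
  case False
  then have pos: "0 < N f"
    using is_norm_onD(2,3)[OF V f] by linarith
  define a where "a = r / (2 * N f)"
  have a: "0 < a" and aN: "a * N f = r / 2"
    using pos r by (simp_all add: a_def)
  have "N (fscale (of_real a) f) < r"
    using is_norm_onD(4)[OF V f, of "of_real a"] a aN r by simp
  then have "p (fscale (of_real a) f) \<le> c"
    using small cfun.subspace_scale[OF is_norm_onD(1)[OF V] f] by blast
  then have "a * p f \<le> c"
    using hom[OF f, of "of_real a"] a by simp
  then have "p f \<le> c / a"
    using a by (simp add: field_simps)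
  also have "c / a = 2 * c / r * N f"
    using pos r by (simp add: a_def field_simps)
  finally show ?thesis .
qed

section \<open>Countable families of seminorms on a Banach space\<close>

text \<open>
  The Baire half of the open mapping argument.  The sets \<open>{f \<in> V. p f \<le> n}\<close> exhaust \<open>V\<close>, so the closure
  of one of them contains a ball around some \<open>f0\<close>.  Subtracting approximations of \<open>f0\<close> from
  approximations of \<open>f0 + f\<close> moves that ball to the origin.  Since \<open>p\<close> need not be lower
  semicontinuous, this bounds \<open>p\<close> only on approximations of \<open>f\<close>, not on \<open>f\<close> itself.
\<close>
lemma Baire_seminorm_approximation:
  assumes Ban: "is_Banach_space V N"
    and scale: "\<And>c f. f \<in> V \<Longrightarrow> p (fscale c f) = cmod c * p f"
    and tri: "\<And>f g. f \<in> V \<Longrightarrow> g \<in> V \<Longrightarrow> p (f + g) \<le> p f + p g"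
  shows "\<exists>r>0. \<forall>t>0. \<forall>f\<in>V. N f < t * r \<longrightarrow> (\<forall>e>0. \<exists>g\<in>V. p g \<le> t \<and> N (f - g) < e)"
proof -
  have V: "is_norm_on V N"
    using Ban by (simp add: is_Banach_space_def)
  note sub = is_norm_onD(1)[OF V] and hom = is_norm_onD(4)[OF V]
  note closed = cfun.subspace_add[OF sub] cfun.subspace_diff[OF sub] cfun.subspace_scale[OF sub]
  interpret Metric_space V "norm_dist V N"
    using V by (rule Metric_space_norm_dist)
  have ptri: "p (f - g) \<le> p f + p g" if "f \<in> V" "g \<in> V" for f g
  proof -
    have "f - g = f + fscale (- 1) g"
      by (simp add: fscale_def fun_eq_iff)
    then show ?thesis
      using tri[OF that(1) closed(3)[OF that(2)], of "- 1"] scale[OF that(2), of "- 1"] by simp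
  qed
  define A where "A n = mtopology closure_of {f \<in> V. p f \<le> real n}" for n :: nat
  have "\<exists>n. mtopology interior_of A n \<noteq> {}"
  proof (rule ccontr)
    assume *: "\<not> ?thesis"
    have "mtopology interior_of \<Union> (range A) = {}"
    proof (rule metric_Baire_category_alt)
      show "mcomplete"
        using Ban by (simp add: is_Banach_space_def)
      fix T assume "T \<in> range A"
      then show "closedin mtopology T \<and> mtopology interior_of T = {}"
        using * by (auto simp: A_def)
    qed auto
    moreover have "\<Union> (range A) = V"
    proof
      show "\<Union> (range A) \<subseteq> V"
        using closure_of_subset_topspace[of mtopology] by (auto simp: A_def)
      show "V \<subseteq> \<Union> (range A)"
      proof
        fix f assume f: "f \<in> V"
        obtain n where "p f \<le> real n"
          using real_arch_simple by blast
        then have "f \<in> A n"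
          using f closure_of_subset[of "{f \<in> V. p f \<le> real n}" mtopology]
          by (auto simp: A_def)
        then show "f \<in> \<Union> (range A)"
          by blast
      qed
    qed
    ultimately show False
      using cfun.subspace_0[OF sub] interior_of_topspace[of mtopology] by auto
  qed
  then obtain n f0 s where f0: "f0 \<in> V" and s: "0 < s" and ball: "mball f0 s \<subseteq> A n"
    by (auto simp: metric_interior_of)
  have near: "\<exists>g\<in>V. p g \<le> real n \<and> N (h - g) < e" if "h \<in> V" "N (f0 - h) < s" "0 < e" for h e
  proof -
    have "h \<in> A n"
      using ball that f0 by (auto simp: norm_dist_def)
    then obtain g where "g \<in> V" "p g \<le> real n" "g \<in> mball h e"
      using \<open>0 < e\<close> unfolding A_def metric_closure_of by auto
    then show ?thesis
      by (auto simp: norm_dist_def)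
  qed
  have diff: "\<exists>g\<in>V. p g \<le> 2 * real n \<and> N (f - g) < e" if f: "f \<in> V" "N f < s" and e: "0 < e" for f e
  proof -
    have "N (f0 - (f0 + f)) = N f"
      using hom[OF f(1), of "- 1"] by (simp add: fscale_def fun_Compl_def)
    then obtain g1 where g1: "g1 \<in> V" "p g1 \<le> real n" "N (f0 + f - g1) < e / 2"
      using near[of "f0 + f" "e / 2"] f e closed(1)[OF f0 f(1)] by auto
    obtain g2 where g2: "g2 \<in> V" "p g2 \<le> real n" "N (f0 - g2) < e / 2"
      using near[of f0 "e / 2"] f0 s e norm_on_zero[OF V] by auto
    have "N (f - (g1 - g2)) = N ((f0 + f - g1) + (g2 - f0))"
      by (simp add: algebra_simps)
    also have "\<dots> \<le> N (f0 + f - g1) + N (g2 - f0)"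
      using f0 f(1) g1(1) g2(1) by (intro is_norm_onD(5)[OF V] closed)
    also have "\<dots> < e"
      using g1(3) g2(3) norm_on_diff_commute[OF V f0 g2(1)] by simp
    finally show ?thesis
      using ptri[OF g1(1) g2(1)] g1 g2 closed(2) by (intro bexI[of _ "g1 - g2"]) auto
  qed
  \<comment> \<open>The summand 1 keeps the scaling factor positive when \<open>n = 0\<close>.\<close>
  define m where "m = 2 * real n + 1"
  have m: "0 < m"
    by (simp add: m_def)
  show ?thesis
  proof (intro exI[of _ "s / m"] conjI allI ballI impI)
    show "0 < s / m"
      using s m by simp
    fix t e :: real and f
    assume t: "0 < t" and f: "f \<in> V" and Nf: "N f < t * (s / m)" and e: "0 < e"
    define a where "a = m / t"
    have a: "0 < a"
      using m t by (simp add: a_def)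
    have "N (fscale (of_real a) f) < s"
    proof -
      have "a * N f < s"
        using Nf t m by (simp add: a_def field_simps)
      then show ?thesis
        using hom[OF f, of "of_real a"] a by simp
    qed
    then obtain g where g: "g \<in> V" "p g \<le> 2 * real n" "N (fscale (of_real a) f - g) < a * e"
      using diff[of "fscale (of_real a) f" "a * e"] closed(3)[OF f] a e by auto
    define b where "b = complex_of_real (1 / a)"
    have nb: "cmod b = 1 / a"
      using a by (simp add: b_def norm_divide)
    have "f - fscale b g = fscale b (fscale (of_real a) f - g)"
      using a by (simp add: fscale_def fun_eq_iff b_def field_simps)
    then have "N (f - fscale b g) = N (fscale (of_real a) f - g) / a"
      using hom[OF closed(2)[OF closed(3)[OF f] g(1)], of b "of_real a"] nb by simp
    also have "\<dots> < e"
      using g(3) a by (simp add: pos_divide_less_eq mult.commute)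
    finally have "N (f - fscale b g) < e" .
    moreover have "p (fscale b g) \<le> t"
    proof -
      have "p (fscale b g) = p g * t / m"
        using scale[OF g(1), of b] nb by (simp add: a_def)
      also have "\<dots> \<le> m * t / m"
        using g(2) t m by (intro divide_right_mono mult_right_mono) (auto simp: m_def)
      finally show ?thesis
        using m by simp
    qed
    ultimately show "\<exists>g\<in>V. p g \<le> t \<and> N (f - g) < e"
      using closed(3)[OF g(1)] by blast
  qed
qed

text \<open>
  A version of Zabreiko's lemma for a sequence of seminorms in place of one: this is the closed graph
  theorem for maps from a Banach space to a Frechet space, with the closed graph replaced by the
  countable subadditivity that it yields.  A series is only required to satisfy the inequality
  if it converges in all the seminorms at once, since in the application no single seminorm
  determines the limit function.

  A vector \<open>f\<close> of small norm is written as a series \<open>\<Sum>k. u k\<close> by repeatedly subtracting approximations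
  from the previous lemma.  The \<open>k\<close>-th term is chosen with respect to the seminorm \<open>p (j + k)\<close>, so
  that \<open>p (j + k) (u k) \<le> (1/2)^k\<close>.  As the seminorms increase, the series then converges
  geometrically in each of them, while \<open>p j f \<le> 2\<close>.
\<close>
lemma Banach_seminorms_bounded:
  fixes p :: "nat \<Rightarrow> (complex \<Rightarrow> complex) \<Rightarrow> real"
  assumes Ban: "is_Banach_space V N"
    and nonneg: "\<And>j f. f \<in> V \<Longrightarrow> 0 \<le> p j f"
    and scale: "\<And>j c f. f \<in> V \<Longrightarrow> p j (fscale c f) = cmod c * p j f"
    and tri: "\<And>j f g. f \<in> V \<Longrightarrow> g \<in> V \<Longrightarrow> p j (f + g) \<le> p j f + p j g"
    and incr: "\<And>i j f. i \<le> j \<Longrightarrow> f \<in> V \<Longrightarrow> p i f \<le> p j f"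
    and subadd: "\<And>j u f. range u \<subseteq> V \<Longrightarrow> f \<in> V \<Longrightarrow> (\<lambda>n. N (f - (\<Sum>k<n. u k))) \<longlonglongrightarrow> 0 \<Longrightarrow>
        (\<And>i. summable (\<lambda>k. p i (u k))) \<Longrightarrow> p j f \<le> (\<Sum>k. p j (u k))"
  shows "\<exists>C. \<forall>f\<in>V. p j f \<le> C * N f"
proof -
  have V: "is_norm_on V N"
    using Ban by (simp add: is_Banach_space_def)
  note sub = is_norm_onD(1)[OF V]
  have "\<exists>r>0. r \<le> 1 \<and> (\<forall>t>0. \<forall>f\<in>V. N f < t * r \<longrightarrow> (\<forall>e>0. \<exists>g\<in>V. p i g \<le> t \<and> N (f - g) < e))" for i
  proof -
    obtain r where r: "0 < r"
      "\<forall>t>0. \<forall>f\<in>V. N f < t * r \<longrightarrow> (\<forall>e>0. \<exists>g\<in>V. p i g \<le> t \<and> N (f - g) < e)"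
      using Baire_seminorm_approximation[OF Ban, of "p i"] scale tri by blast
    have "x < t * r" if "0 < t" "x < t * min r 1" for t x
      using that less_le_trans[OF that(2) mult_left_mono[of "min r 1" r t]] by simp
    then show ?thesis
      using r by (intro exI[of _ "min r 1"]) simp
  qed
  then obtain r where r: "\<And>i. 0 < r i" "\<And>i. r i \<le> 1"
    and approx: "\<And>i t f e. 0 < t \<Longrightarrow> f \<in> V \<Longrightarrow> N f < t * r i \<Longrightarrow> 0 < e \<Longrightarrow>
      \<exists>g\<in>V. p i g \<le> t \<and> N (f - g) < e"
    by metis
  have unit: "p j f \<le> 2" if f: "f \<in> V" "N f < r j" for f
  proof -
    \<comment> \<open>\<open>h n\<close> is the remainder of \<open>f\<close> after \<open>n\<close> steps, small enough to be approximated in \<open>p (j + n)\<close>.\<close>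
    have "\<exists>h. \<forall>n. (h n \<in> V \<and> N (h n) < (1 / 2) ^ n * r (j + n) \<and> (n = 0 \<longrightarrow> h n = f)) \<and>
        p (j + n) (h n - h (Suc n)) \<le> (1 / 2) ^ n"
    proof (rule dependent_nat_choice)
      show "\<exists>x. x \<in> V \<and> N x < (1 / 2) ^ 0 * r (j + 0) \<and> (0 = 0 \<longrightarrow> x = f)"
        using f by simp
      fix x and n :: nat
      assume x: "x \<in> V \<and> N x < (1 / 2) ^ n * r (j + n) \<and> (n = 0 \<longrightarrow> x = f)"
      then obtain g where g: "g \<in> V" "p (j + n) g \<le> (1 / 2) ^ n"
        "N (x - g) < (1 / 2) ^ Suc n * r (j + Suc n)"
        using approx[of "(1 / 2) ^ n" x "j + n" "(1 / 2) ^ Suc n * r (j + Suc n)"] r by auto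
      then show "\<exists>y. (y \<in> V \<and> N y < (1 / 2) ^ Suc n * r (j + Suc n) \<and> (Suc n = 0 \<longrightarrow> y = f)) \<and>
          p (j + n) (x - y) \<le> (1 / 2) ^ n"
        using x cfun.subspace_diff[OF sub] by (intro exI[of _ "x - g"]) auto
    qed
    then obtain h where h: "\<And>n. h n \<in> V" "\<And>n. N (h n) < (1 / 2) ^ n * r (j + n)" "h 0 = f"
      "\<And>n. p (j + n) (h n - h (Suc n)) \<le> (1 / 2) ^ n"
      by blast
    define u where "u n = h n - h (Suc n)" for n
    have u: "u n \<in> V" for n
      using h(1) cfun.subspace_diff[OF sub] by (simp add: u_def)
    have geo: "summable (\<lambda>n. (1 / 2 :: real) ^ n)"
      by (rule summable_geometric) simp
    have "f - (\<Sum>k<n. u k) = h n" for n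
    proof (induction n)
      case (Suc n)
      have "f - (\<Sum>k<Suc n. u k) = (f - (\<Sum>k<n. u k)) - u n"
        by (simp only: sum.lessThan_Suc diff_diff_eq)
      also have "\<dots> = h (Suc n)"
        unfolding Suc by (simp add: u_def fun_eq_iff)
      finally show ?case .
    qed (simp add: h(3))
    moreover have "(\<lambda>n. N (h n)) \<longlonglongrightarrow> 0"
    proof (rule tendsto_sandwich[OF _ _ tendsto_const])
      show "\<forall>\<^sub>F n in sequentially. 0 \<le> N (h n)"
        using is_norm_onD(2)[OF V h(1)] by simp
      have "N (h n) \<le> (1 / 2) ^ n" for n
        using less_imp_le[OF h(2)] by (rule order_trans) (simp add: mult_left_le r(2))
      then show "\<forall>\<^sub>F n in sequentially. N (h n) \<le> (1 / 2) ^ n"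
        by simp
      show "(\<lambda>n. (1 / 2 :: real) ^ n) \<longlonglongrightarrow> 0"
        using geo by (rule summable_LIMSEQ_zero)
    qed
    ultimately have conv: "(\<lambda>n. N (f - (\<Sum>k<n. u k))) \<longlonglongrightarrow> 0"
      by simp
    have bound: "p i (u n) \<le> (1 / 2) ^ n" if "i \<le> j + n" for i n
      using order_trans[OF incr[OF that u] h(4)[of n, folded u_def]] .
    have summ: "summable (\<lambda>k. p i (u k))" for i
    proof (rule summable_comparison_test_ev[OF _ geo])
      show "\<forall>\<^sub>F n in sequentially. norm (p i (u n)) \<le> (1 / 2) ^ n"
        using eventually_ge_at_top[of i] by eventually_elim (simp add: nonneg u bound)
    qed
    have "p j f \<le> (\<Sum>k. p j (u k))"
      using subadd[OF _ f(1) conv summ] u by blast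
    also have "\<dots> \<le> (\<Sum>k. (1 / 2) ^ k)"
      by (rule suminf_le[OF bound summ geo]) simp
    also have "\<dots> = 2"
      by (subst suminf_geometric) simp_all
    finally show ?thesis .
  qed
  show ?thesis
    using norm_bound_by_homogeneity[where p = "p j", OF V r(1) unit scale] by blast
qed

section \<open>Locally bounded evaluations\<close>

definition evaluations_locally_bounded ::
  "complex set \<Rightarrow> (complex \<Rightarrow> complex) set \<Rightarrow> ((complex \<Rightarrow> complex) \<Rightarrow> real) \<Rightarrow> bool" where
  "evaluations_locally_bounded G V N \<longleftrightarrow>
     (\<forall>K. compact K \<and> K \<subseteq> G \<longrightarrow> (\<exists>C. \<forall>f\<in>V. \<forall>z\<in>K. cmod (f z) \<le> C * N f))"

lemma evaluations_locally_boundedE: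
  assumes "evaluations_locally_bounded G V N" "is_norm_on V N" "compact K" "K \<subseteq> G"
  obtains C where "0 < C" "\<forall>f\<in>V. \<forall>z\<in>K. cmod (f z) \<le> C * N f"
proof -
  obtain C where C: "\<forall>f\<in>V. \<forall>z\<in>K. cmod (f z) \<le> C * N f"
    using assms unfolding evaluations_locally_bounded_def by blast
  have "cmod (f z) \<le> max C 1 * N f" if "f \<in> V" "z \<in> K" for f z
    using C that mult_right_mono[OF max.cobounded1 is_norm_onD(2)[OF assms(2) that(1)], of C 1]
    by (meson order_trans)
  then show thesis
    using that[of "max C 1"] by simp
qed

lemma evaluations_locally_bounded_if_small:
  assumes V: "is_norm_on V N"
    and small: "\<And>K. compact K \<Longrightarrow> K \<subseteq> G \<Longrightarrow>
      \<exists>r>0. \<exists>c. \<forall>f\<in>V. N f < r \<longrightarrow> (\<forall>z\<in>K. cmod (f z) \<le> c)"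
  shows "evaluations_locally_bounded G V N"
  unfolding evaluations_locally_bounded_def
proof (intro allI impI)
  fix K assume "compact K \<and> K \<subseteq> G"
  then obtain r c where r: "0 < r" and c: "\<forall>f\<in>V. N f < r \<longrightarrow> (\<forall>z\<in>K. cmod (f z) \<le> c)"
    using small by metis
  have "cmod (f z) \<le> 2 * c / r * N f" if "f \<in> V" "z \<in> K" for f z
    by (rule norm_bound_by_homogeneity[where p = "\<lambda>f. cmod (f z)", OF V r _ _ that(1)])
      (use c that(2) in \<open>auto simp: fscale_def norm_mult\<close>)
  then show "\<exists>C. \<forall>f\<in>V. \<forall>z\<in>K. cmod (f z) \<le> C * N f"
    by blast
qed

lemma evaluations_locally_bounded_iff_unit_ball:
  assumes V: "is_norm_on V N"
  shows "evaluations_locally_bounded G V N \<longleftrightarrow>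
    (\<forall>K. compact K \<and> K \<subseteq> G \<longrightarrow> (\<exists>c. \<forall>f\<in>closed_unit_ball V N. \<forall>z\<in>K. cmod (f z) \<le> c))"
    (is "_ \<longleftrightarrow> ?R")
proof
  assume B: "evaluations_locally_bounded G V N"
  show ?R
  proof (intro allI impI)
    fix K assume "compact K \<and> K \<subseteq> G"
    then obtain C where C: "0 < C" "\<forall>f\<in>V. \<forall>z\<in>K. cmod (f z) \<le> C * N f"
      using evaluations_locally_boundedE[OF B V] by auto
    have "cmod (f z) \<le> C" if "f \<in> closed_unit_ball V N" "z \<in> K" for f z
    proof -
      have "f \<in> V" "N f \<le> 1"
        using that(1) by (simp_all add: closed_unit_ball_def)
      then show ?thesis
        using C(2)[rule_format, of f z] that(2) mult_left_le[of "N f" C] C(1) by linarith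
    qed
    then show "\<exists>c. \<forall>f\<in>closed_unit_ball V N. \<forall>z\<in>K. cmod (f z) \<le> c"
      by blast
  qed
next
  assume R: ?R
  show "evaluations_locally_bounded G V N"
  proof (rule evaluations_locally_bounded_if_small[OF V])
    fix K assume "compact K" "K \<subseteq> G"
    then obtain c where "\<forall>f\<in>closed_unit_ball V N. \<forall>z\<in>K. cmod (f z) \<le> c"
      using R by blast
    then show "\<exists>r>0. \<exists>c. \<forall>f\<in>V. N f < r \<longrightarrow> (\<forall>z\<in>K. cmod (f z) \<le> c)"
      by (intro exI[of _ 1] conjI exI[of _ c]) (auto simp: closed_unit_ball_def)
  qed
qed

section \<open>The compact-open topology\<close>

text \<open>
  The bound \<open>d < e\<close> uniform on \<open>K\<close> leaves the room \<open>e - d\<close> around each member, which shows openness without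
  attaining the maximum of \<open>\<bar>g - f\<bar>\<close> on \<open>K\<close>.
\<close>
lemma openin_tau_co_tube:
  assumes "compact K" "K \<subseteq> G"
  shows "openin (tau_co G) {g \<in> hol_space G. \<exists>d<e. \<forall>z\<in>K. cmod (g z - f z) \<le> d}" (is "openin _ ?U")
  unfolding openin_tau_co co_open_def
proof (intro conjI ballI)
  fix g assume "g \<in> ?U"
  then obtain d where d: "d < e" "\<forall>z\<in>K. cmod (g z - f z) \<le> d"
    by blast
  have "h \<in> ?U" if h: "h \<in> hol_space G" "\<forall>z\<in>K. cmod (h z - g z) < (e - d) / 2" for h
  proof -
    have "cmod (h z - f z) \<le> (e - d) / 2 + d" if "z \<in> K" for z
    proof -
      have "cmod (h z - f z) \<le> cmod (h z - g z) + cmod (g z - f z)"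
        using norm_triangle_ineq[of "h z - g z" "g z - f z"] by simp
      then show ?thesis
        using bspec[OF h(2) that] bspec[OF d(2) that] by linarith
    qed
    moreover have "(e - d) / 2 + d < e"
      using d(1) by (simp add: field_simps)
    ultimately show ?thesis
      using h(1) by blast
  qed
  then show "\<exists>K \<epsilon>. compact K \<and> K \<subseteq> G \<and> 0 < \<epsilon> \<and>
      {h \<in> hol_space G. \<forall>z\<in>K. cmod (h z - g z) < \<epsilon>} \<subseteq> ?U"
    using assms d(1) by (intro exI[of _ K] exI[of _ "(e - d) / 2"]) auto
qed blast

lemma limitin_tau_co:
  "limitin (tau_co G) \<sigma> g sequentially \<longleftrightarrow>
    g \<in> hol_space G \<and> (\<forall>\<^sub>F n in sequentially. \<sigma> n \<in> hol_space G) \<and>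
    (\<forall>K. compact K \<and> K \<subseteq> G \<longrightarrow> uniform_limit K \<sigma> g sequentially)" (is "?L \<longleftrightarrow> ?R")
proof
  assume L: ?L
  then have g: "g \<in> hol_space G"
    by (simp add: limitin_def topspace_tau_co)
  have ev: "\<forall>\<^sub>F n in sequentially. \<sigma> n \<in> U" if "openin (tau_co G) U" "g \<in> U" for U
    using L that by (simp add: limitin_def)
  have "uniform_limit K \<sigma> g sequentially" if K: "compact K" "K \<subseteq> G" for K
  proof (rule uniform_limitI)
    fix e :: real assume e: "0 < e"
    have "g \<in> {h \<in> hol_space G. \<exists>d<e. \<forall>z\<in>K. cmod (h z - g z) \<le> d}"
      using g e by auto
    from ev[OF openin_tau_co_tube[OF K] this]
    show "\<forall>\<^sub>F n in sequentially. \<forall>z\<in>K. dist (\<sigma> n z) (g z) < e"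
      by eventually_elim (auto simp: dist_norm intro: le_less_trans)
  qed
  then show ?R
    using g ev[of "hol_space G"] openin_topspace[of "tau_co G"] by (simp add: topspace_tau_co)
next
  assume R: ?R
  show ?L
    unfolding limitin_def
  proof (intro conjI allI impI)
    show "g \<in> topspace (tau_co G)"
      using R by (simp add: topspace_tau_co)
    fix U assume "openin (tau_co G) U \<and> g \<in> U"
    then have "co_open G U" "g \<in> U"
      by (simp_all add: openin_tau_co)
    then obtain K e where K: "compact K" "K \<subseteq> G" and e: "0 < e"
      and U: "{h \<in> hol_space G. \<forall>z\<in>K. cmod (h z - g z) < e} \<subseteq> U"
      by (rule co_openE)
    have "\<forall>\<^sub>F n in sequentially. \<forall>z\<in>K. dist (\<sigma> n z) (g z) < e"
      using R K e by (auto dest: uniform_limitD)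
    moreover have "\<forall>\<^sub>F n in sequentially. \<sigma> n \<in> hol_space G"
      using R by blast
    ultimately show "\<forall>\<^sub>F n in sequentially. \<sigma> n \<in> U"
      by eventually_elim (use U in \<open>auto simp: dist_norm\<close>)
  qed
qed

lemma hol_space_continuous_on: "f \<in> hol_space G \<Longrightarrow> K \<subseteq> G \<Longrightarrow> continuous_on K f"
  by (auto simp: hol_space_def intro: continuous_on_subset dest: holomorphic_on_imp_continuous_on)

lemma hol_space_uniform_limit:
  assumes G: "open G" and f: "\<And>n. f n \<in> hol_space G"
    and lim: "\<And>z. z \<in> G \<Longrightarrow> \<exists>d>0. cball z d \<subseteq> G \<and> uniform_limit (cball z d) f g sequentially"
    and g0: "\<And>z. z \<notin> G \<Longrightarrow> g z = 0"
  shows "g \<in> hol_space G"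
  using holomorphic_uniform_sequence[OF G _ lim] f g0 by (auto simp: hol_space_def)

lemma hol_space_diff: "f \<in> hol_space G \<Longrightarrow> g \<in> hol_space G \<Longrightarrow> f - g \<in> hol_space G"
  by (auto simp: hol_space_def fun_diff_def intro: holomorphic_on_diff)

section \<open>Characterizations of locally bounded evaluations\<close>

lemma evaluations_locally_bounded_iff_inclusion_continuous:
  assumes V: "is_norm_on V N" and VG: "V \<subseteq> hol_space G"
  shows "evaluations_locally_bounded G V N \<longleftrightarrow>
    continuous_map (norm_topology V N) (tau_co G) (\<lambda>f. f)"
proof
  assume B: "evaluations_locally_bounded G V N"
  show "continuous_map (norm_topology V N) (tau_co G) (\<lambda>f. f)"
    unfolding continuous_map_def topspace_norm_topology[OF V] topspace_tau_co
      openin_norm_topology[OF V]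
  proof (intro conjI allI impI ballI)
    fix U f assume "openin (tau_co G) U" and f: "f \<in> {f \<in> V. f \<in> U}"
    then have "co_open G U" "f \<in> U"
      by (simp_all add: openin_tau_co)
    then obtain K e where K: "compact K" "K \<subseteq> G" and e: "0 < e"
      and U: "{h \<in> hol_space G. \<forall>z\<in>K. cmod (h z - f z) < e} \<subseteq> U"
      by (rule co_openE)
    obtain C where C: "0 < C" "\<forall>f\<in>V. \<forall>z\<in>K. cmod (f z) \<le> C * N f"
      by (rule evaluations_locally_boundedE[OF B V K])
    have "g \<in> U" if g: "g \<in> V" "N (f - g) < e / C" for g
    proof -
      have "cmod (g z - f z) < e" if "z \<in> K" for z
      proof -
        have "cmod (g z - f z) = cmod ((f - g) z)"
          by (simp add: norm_minus_commute)
        also have "\<dots> \<le> C * N (f - g)"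
          using C(2)[rule_format, OF cfun.subspace_diff[OF is_norm_onD(1)[OF V]] that] f g(1) by simp
        also have "\<dots> < e"
          using g(2) C(1) by (simp add: field_simps)
        finally show ?thesis .
      qed
      then show ?thesis
        using U VG g(1) by blast
    qed
    then show "\<exists>r>0. \<forall>g\<in>V. N (f - g) < r \<longrightarrow> g \<in> {f \<in> V. f \<in> U}"
      using e C(1) by (intro exI[of _ "e / C"]) auto
  qed (use VG in auto)
next
  assume cont: "continuous_map (norm_topology V N) (tau_co G) (\<lambda>f. f)"
  have V0: "0 \<in> V"
    using cfun.subspace_0[OF is_norm_onD(1)[OF V]] .
  show "evaluations_locally_bounded G V N"
  proof (rule evaluations_locally_bounded_if_small[OF V])
    fix K assume K: "compact K" "K \<subseteq> G"
    let ?U = "{g \<in> hol_space G. \<exists>d<1. \<forall>z\<in>K. cmod (g z - 0) \<le> d}"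
    have "openin (norm_topology V N) {f \<in> V. f \<in> ?U}"
      using openin_continuous_map_preimage[OF cont openin_tau_co_tube[OF K, where e = 1 and f = "\<lambda>_. 0"]]
      by (simp add: topspace_norm_topology[OF V])
    moreover have "0 \<in> {f \<in> V. f \<in> ?U}"
      using V0 VG by (auto intro!: exI[of _ "0 :: real"])
    ultimately obtain r where r: "0 < r" "\<forall>g\<in>V. N g < r \<longrightarrow> g \<in> {f \<in> V. f \<in> ?U}"
      by (rule norm_topology_zero_nhdE[OF V])
    have "cmod (f z) \<le> 1" if "f \<in> V" "N f < r" "z \<in> K" for f z
    proof -
      have "f \<in> ?U"
        using r(2)[rule_format, OF that(1,2)] by simp
      then show ?thesis
        using that(3) by force
    qed
    then show "\<exists>r>0. \<exists>c. \<forall>f\<in>V. N f < r \<longrightarrow> (\<forall>z\<in>K. cmod (f z) \<le> c)"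
      using r(1) by blast
  qed
qed

lemma evaluations_locally_bounded_iff_tvs_bounded:
  assumes V: "is_norm_on V N" and VG: "V \<subseteq> hol_space G"
  shows "evaluations_locally_bounded G V N \<longleftrightarrow> tvs_bounded (tau_co G) (closed_unit_ball V N)"
proof
  assume B: "evaluations_locally_bounded G V N"
  show "tvs_bounded (tau_co G) (closed_unit_ball V N)"
    unfolding tvs_bounded_def topspace_tau_co
  proof (intro conjI allI impI)
    show "closed_unit_ball V N \<subseteq> hol_space G"
      using VG by (auto simp: closed_unit_ball_def)
    fix U :: "(complex \<Rightarrow> complex) set" assume "openin (tau_co G) U \<and> 0 \<in> U"
    then have "co_open G U" "0 \<in> U"
      by (simp_all add: openin_tau_co)
    then obtain K e where K: "compact K" "K \<subseteq> G" and e: "0 < e"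
      and U: "{h \<in> hol_space G. \<forall>z\<in>K. cmod (h z - (0 :: complex \<Rightarrow> complex) z) < e} \<subseteq> U"
      by (rule co_openE)
    obtain C where C: "0 < C" "\<forall>f\<in>V. \<forall>z\<in>K. cmod (f z) \<le> C * N f"
      by (rule evaluations_locally_boundedE[OF B V K])
    have "closed_unit_ball V N \<subseteq> fscale (of_real t) ` U" if t: "C / e < t" for t
    proof
      fix f assume f: "f \<in> closed_unit_ball V N"
      then have fV: "f \<in> V" "N f \<le> 1"
        by (auto simp: closed_unit_ball_def)
      have t0: "0 < t"
        using t C(1) e by (meson divide_pos_pos less_trans)
      define g where "g = fscale (of_real (1 / t)) f"
      have "g \<in> V"
        using cfun.subspace_scale[OF is_norm_onD(1)[OF V] fV(1)] by (simp add: g_def)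
      moreover have "cmod (g z) < e" if "z \<in> K" for z
      proof -
        have "cmod (g z) = cmod (f z) / t"
          using t0 by (simp add: g_def fscale_def norm_mult norm_divide)
        also have "\<dots> \<le> C / t"
          using C(2)[rule_format, OF fV(1) that] mult_left_le[OF fV(2), of C] C(1) t0
          by (intro divide_right_mono) linarith+
        also have "\<dots> < e"
          using t t0 e by (simp add: field_simps)
        finally show ?thesis .
      qed
      ultimately have "g \<in> U"
        using U VG by auto
      moreover have "f = fscale (of_real t) g"
        using t0 by (simp add: g_def fscale_def fun_eq_iff)
      ultimately show "f \<in> fscale (of_real t) ` U"
        by blast
    qed
    then show "\<exists>s>0. \<forall>t>s. closed_unit_ball V N \<subseteq> fscale (of_real t) ` U"
      using C(1) e by (intro exI[of _ "C / e"]) auto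
  qed
next
  assume T: "tvs_bounded (tau_co G) (closed_unit_ball V N)"
  show "evaluations_locally_bounded G V N"
    unfolding evaluations_locally_bounded_iff_unit_ball[OF V]
  proof (intro allI impI)
    fix K assume K: "compact K \<and> K \<subseteq> G"
    let ?U = "{g \<in> hol_space G. \<exists>d<1. \<forall>z\<in>K. cmod (g z - 0) \<le> d}"
    have "0 \<in> ?U"
      using cfun.subspace_0[OF is_norm_onD(1)[OF V]] VG by (auto intro!: exI[of _ "0 :: real"])
    moreover have "openin (tau_co G) ?U"
      using K by (intro openin_tau_co_tube) auto
    ultimately have "\<exists>s>0. \<forall>t>s. closed_unit_ball V N \<subseteq> fscale (complex_of_real t) ` ?U"
      using T unfolding tvs_bounded_def by simp
    then obtain s where s: "0 < s"
      "\<forall>t>s. closed_unit_ball V N \<subseteq> fscale (complex_of_real t) ` ?U"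
      by (elim exE conjE)
    have "cmod (f z) \<le> s + 1" if f: "f \<in> closed_unit_ball V N" and z: "z \<in> K" for f z
    proof -
      have "f \<in> fscale (complex_of_real (s + 1)) ` ?U"
        using s(2)[rule_format, of "s + 1"] f by auto
      then obtain g where g: "g \<in> ?U" and fg: "f = fscale (of_real (s + 1)) g"
        using imageE[of f "fscale (complex_of_real (s + 1))" ?U thesis] by blast
      have "cmod (g z) \<le> 1"
        using g z by force
      moreover have "cmod (f z) = (s + 1) * cmod (g z)"
        using s(1) by (simp add: fg fscale_def norm_mult del: of_real_add)
      ultimately show ?thesis
        using s(1) by (simp add: mult_left_le)
    qed
    then show "\<exists>c. \<forall>f\<in>closed_unit_ball V N. \<forall>z\<in>K. cmod (f z) \<le> c"
      by blast
  qed
qed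

text \<open>
  For the converse direction, if the estimate fails on \<open>K\<close>, choose \<open>\<sigma> n\<close> in the unit ball with a value
  larger than \<open>n\<close> on \<open>K\<close>.  If a subsequence converged uniformly on \<open>K\<close>, its limit would be bounded on
  \<open>K\<close>, and the values of its late terms on \<open>K\<close> would be bounded by a common constant.
\<close>
lemma evaluations_locally_bounded_iff_normal_family:
  assumes G: "open G" and V: "is_norm_on V N" and VG: "V \<subseteq> hol_space G"
  shows "evaluations_locally_bounded G V N \<longleftrightarrow>
    (\<forall>\<sigma>::nat \<Rightarrow> complex \<Rightarrow> complex.
        range \<sigma> \<subseteq> V \<and> (\<exists>C. \<forall>n. N (\<sigma> n) \<le> C) \<longrightarrow> normal_family G (range \<sigma>))" (is "_ \<longleftrightarrow> ?R")
proof
  assume B: "evaluations_locally_bounded G V N"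
  show ?R
  proof (intro allI impI)
    fix \<sigma> :: "nat \<Rightarrow> complex \<Rightarrow> complex"
    assume "range \<sigma> \<subseteq> V \<and> (\<exists>C. \<forall>n. N (\<sigma> n) \<le> C)"
    then obtain M where \<sigma>: "range \<sigma> \<subseteq> V" and M: "\<And>n. N (\<sigma> n) \<le> M"
      by blast
    show "normal_family G (range \<sigma>)"
      unfolding normal_family_def
    proof (intro conjI allI impI)
      show \<sigma>G: "range \<sigma> \<subseteq> hol_space G"
        using \<sigma> VG by blast
      fix \<tau> :: "nat \<Rightarrow> complex \<Rightarrow> complex" assume \<tau>: "range \<tau> \<subseteq> range \<sigma>"
      have bd: "\<exists>B. \<forall>h\<in>range \<sigma>. \<forall>z\<in>K. cmod (h z) \<le> B" if K: "compact K" "K \<subseteq> G" for K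
      proof -
        obtain C where C: "0 < C" "\<forall>f\<in>V. \<forall>z\<in>K. cmod (f z) \<le> C * N f"
          by (rule evaluations_locally_boundedE[OF B V K])
        have "cmod (\<sigma> n z) \<le> C * M" if "z \<in> K" for n z
          using C(2)[rule_format, OF subsetD[OF \<sigma> rangeI] that, of n]
            mult_left_mono[OF M less_imp_le[OF C(1)], of n] by (rule order_trans)
        then show ?thesis
          by blast
      qed
      have hol: "h holomorphic_on G" if "h \<in> range \<sigma>" for h
        using \<sigma>G that by (auto simp: hol_space_def)
      have "\<exists>g r. g holomorphic_on G \<and> strict_mono (r :: nat \<Rightarrow> nat) \<and>
          (\<forall>K. compact K \<and> K \<subseteq> G \<longrightarrow> uniform_limit K (\<tau> \<circ> r) g sequentially)"
      proof (rule Montel[OF G hol bd \<tau>])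
        fix g and r :: "nat \<Rightarrow> nat"
        assume "g holomorphic_on G" "strict_mono r"
          "\<And>K. compact K \<Longrightarrow> K \<subseteq> G \<Longrightarrow> uniform_limit K (\<tau> \<circ> r) g sequentially"
        then show ?thesis
          by (intro exI[of _ g] exI[of _ r]) simp
      qed
      then obtain g r where g: "g holomorphic_on G" and r: "strict_mono (r :: nat \<Rightarrow> nat)"
        and lim: "\<forall>K. compact K \<and> K \<subseteq> G \<longrightarrow> uniform_limit K (\<tau> \<circ> r) g sequentially"
        by (elim exE conjE)
      \<comment> \<open>The limit is determined only on \<open>G\<close>; members of \<open>hol_space G\<close> vanish outside.\<close>
      define g' where "g' z = (if z \<in> G then g z else 0)" for z
      have "g' holomorphic_on G"
        using g by (rule holomorphic_transform) (simp add: g'_def)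
      then have g': "g' \<in> hol_space G"
        by (simp add: hol_space_def g'_def)
      have "uniform_limit K (\<tau> \<circ> r) g' sequentially" if K: "compact K" "K \<subseteq> G" for K
      proof -
        have "uniform_limit K (\<tau> \<circ> r) g sequentially \<longleftrightarrow> uniform_limit K (\<tau> \<circ> r) g' sequentially"
          by (rule uniform_limit_cong) (use K in \<open>auto simp: g'_def\<close>)
        then show ?thesis
          using lim K by simp
      qed
      moreover have "(\<tau> \<circ> r) n \<in> hol_space G" for n
        using \<tau> \<sigma>G by auto
      ultimately have "limitin (tau_co G) (\<tau> \<circ> r) g' sequentially"
        using g' by (simp add: limitin_tau_co)
      then show "\<exists>g r. strict_mono (r::nat \<Rightarrow> nat) \<and> limitin (tau_co G) (\<tau> \<circ> r) g sequentially"
        using r by blast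
    qed
  qed
next
  assume R: ?R
  show "evaluations_locally_bounded G V N"
    unfolding evaluations_locally_bounded_iff_unit_ball[OF V]
  proof (intro allI impI, rule ccontr)
    fix K assume K: "compact K \<and> K \<subseteq> G"
      and unbdd: "\<not> (\<exists>c. \<forall>f\<in>closed_unit_ball V N. \<forall>z\<in>K. cmod (f z) \<le> c)"
    then have "\<forall>n. \<exists>f\<in>closed_unit_ball V N. \<exists>z\<in>K. real n < cmod (f z)"
      by (meson not_le)
    then obtain \<sigma> \<zeta> where \<sigma>: "\<And>n. \<sigma> n \<in> closed_unit_ball V N" and \<zeta>: "\<And>n. \<zeta> n \<in> K"
      and large: "\<And>n. real n < cmod (\<sigma> n (\<zeta> n))"
      by metis
    have "normal_family G (range \<sigma>)"
      using \<sigma> R by (auto simp: closed_unit_ball_def)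
    then obtain g r where r: "strict_mono (r :: nat \<Rightarrow> nat)"
      and lim: "limitin (tau_co G) (\<sigma> \<circ> r) g sequentially"
      unfolding normal_family_def by blast
    have "continuous_on K g"
      using lim K by (intro hol_space_continuous_on[of _ G]) (simp_all add: limitin_tau_co)
    then have "bounded (g ` K)"
      using K compact_continuous_image compact_imp_bounded by blast
    then obtain M where M: "\<And>z. z \<in> K \<Longrightarrow> cmod (g z) \<le> M"
      unfolding bounded_iff by blast
    have "uniform_limit K (\<sigma> \<circ> r) g sequentially"
      using lim K by (simp add: limitin_tau_co)
    then have "\<forall>\<^sub>F n in sequentially. \<forall>z\<in>K. dist ((\<sigma> \<circ> r) n z) (g z) < 1"
      by (rule uniform_limitD) simp
    moreover have "\<forall>\<^sub>F n in sequentially. M + 1 \<le> real n"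
      by (rule eventually_at_top_linorderI[of "nat \<lceil>M + 1\<rceil>"]) linarith
    ultimately have "\<forall>\<^sub>F n in sequentially. False"
    proof eventually_elim
      case (elim n)
      have "real n \<le> real (r n)"
        using seq_suble[OF r] by simp
      also have "\<dots> < cmod (\<sigma> (r n) (\<zeta> (r n)))"
        by (rule large)
      also have "\<dots> \<le> cmod (\<sigma> (r n) (\<zeta> (r n)) - g (\<zeta> (r n))) + cmod (g (\<zeta> (r n)))"
        using norm_triangle_ineq[of "\<sigma> (r n) (\<zeta> (r n)) - g (\<zeta> (r n))" "g (\<zeta> (r n))"] by simp
      also have "\<dots> < 1 + M"
        using elim(1) M \<zeta>[of "r n"] by (intro add_less_le_mono) (auto simp: dist_norm)
      finally show False
        using elim(2) by simp
    qed
    then show False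
      by simp
  qed
qed

text \<open>
  Continuity of the single evaluations is what makes each \<open>dual_norm\<close> a supremum of a bounded set,
  so that a bound on the dual norms over \<open>K\<close> is a bound for the unit ball on \<open>K\<close>.
\<close>
lemma evaluations_locally_bounded_iff_dual_norm:
  assumes V: "is_norm_on V N"
  shows "evaluations_locally_bounded G V N \<longleftrightarrow>
    (\<forall>z\<in>G. (\<lambda>f. f z) \<in> dual_space V N) \<and>
    (\<forall>K. compact K \<and> K \<subseteq> G \<longrightarrow> bdd_above ((\<lambda>z. dual_norm V N (\<lambda>f. f z)) ` K))" (is "_ \<longleftrightarrow> ?R")
proof
  have V0: "0 \<in> V"
    using cfun.subspace_0[OF is_norm_onD(1)[OF V]] .
  assume B: "evaluations_locally_bounded G V N"
  have "(\<lambda>f. f z) \<in> dual_space V N" if z: "z \<in> G" for z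
  proof -
    obtain C where C: "0 < C" "\<forall>f\<in>V. \<forall>w\<in>{z}. cmod (f w) \<le> C * N f"
      using evaluations_locally_boundedE[OF B V, of "{z}"] z by auto
    have "continuous_map (norm_topology V N) euclidean (\<lambda>f. f z)"
      unfolding continuous_map_def topspace_norm_topology[OF V] openin_norm_topology[OF V]
    proof (intro conjI allI impI ballI)
      fix U f assume "openin euclidean U" and f: "f \<in> {f \<in> V. f z \<in> U}"
      then obtain e where e: "0 < e" "ball (f z) e \<subseteq> U"
        by (auto elim: openE)
      have "g z \<in> U" if g: "g \<in> V" "N (f - g) < e / C" for g
      proof -
        have "dist (f z) (g z) \<le> C * N (f - g)"
          using C(2)[rule_format, of "f - g" z] cfun.subspace_diff[OF is_norm_onD(1)[OF V]] f g(1)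
          by (simp add: dist_norm)
        also have "\<dots> < e"
          using g(2) C(1) by (simp add: field_simps)
        finally show ?thesis
          using e(2) by auto
      qed
      then show "\<exists>r>0. \<forall>g\<in>V. N (f - g) < r \<longrightarrow> g \<in> {f \<in> V. f z \<in> U}"
        using e(1) C(1) by (intro exI[of _ "e / C"]) auto
    qed auto
    then show ?thesis
      by (simp add: dual_space_def fscale_def)
  qed
  moreover have "bdd_above ((\<lambda>z. dual_norm V N (\<lambda>f. f z)) ` K)" if K: "compact K" "K \<subseteq> G" for K
  proof -
    obtain c where c: "\<forall>f\<in>closed_unit_ball V N. \<forall>z\<in>K. cmod (f z) \<le> c"
      using B K unfolding evaluations_locally_bounded_iff_unit_ball[OF V] by blast
    have "0 \<in> closed_unit_ball V N"
      using V0 norm_on_zero[OF V] by (simp add: closed_unit_ball_def)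
    then have "dual_norm V N (\<lambda>f. f z) \<le> c" if "z \<in> K" for z
      unfolding dual_norm_def using c that by (intro cSUP_least) auto
    then show ?thesis
      by (rule bdd_aboveI2)
  qed
  ultimately show ?R
    by simp
next
  assume R: ?R
  have V0: "0 \<in> V"
    using cfun.subspace_0[OF is_norm_onD(1)[OF V]] .
  have bdd: "bdd_above ((\<lambda>f. cmod (f z)) ` closed_unit_ball V N)" if z: "z \<in> G" for z
  proof -
    have "continuous_map (norm_topology V N) euclidean (\<lambda>f. f z)"
      using R z by (auto simp: dual_space_def)
    from openin_continuous_map_preimage[OF this, of "ball 0 1"]
    have "openin (norm_topology V N) {f \<in> V. f z \<in> ball 0 1}"
      by (simp add: topspace_norm_topology[OF V])
    moreover have "0 \<in> {f \<in> V. f z \<in> ball 0 1}"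
      using V0 by simp
    ultimately obtain r where r: "0 < r" "\<forall>g\<in>V. N g < r \<longrightarrow> g \<in> {f \<in> V. f z \<in> ball 0 1}"
      by (rule norm_topology_zero_nhdE[OF V])
    have small: "cmod (f z) \<le> 1" if "f \<in> V" "N f < r" for f
      using r(2)[rule_format, OF that] by simp
    have bound: "cmod (f z) \<le> 2 * 1 / r * N f" if "f \<in> V" for f
      by (rule norm_bound_by_homogeneity[where p = "\<lambda>f. cmod (f z)", OF V r(1) _ _ that])
        (simp_all add: small fscale_def norm_mult)
    have "cmod (f z) \<le> 2 * 1 / r" if f: "f \<in> closed_unit_ball V N" for f
    proof -
      have "f \<in> V" "N f \<le> 1"
        using f by (simp_all add: closed_unit_ball_def)
      then show ?thesis
        using bound[of f] mult_left_le[of "N f" "2 * 1 / r"] r(1) by simp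
    qed
    then show ?thesis
      by (rule bdd_aboveI2)
  qed
  show "evaluations_locally_bounded G V N"
    unfolding evaluations_locally_bounded_iff_unit_ball[OF V]
  proof (intro allI impI)
    fix K assume K: "compact K \<and> K \<subseteq> G"
    then have bK: "bdd_above ((\<lambda>z. dual_norm V N (\<lambda>f. f z)) ` K)"
      using R by simp
    have "cmod (f z) \<le> (SUP z\<in>K. dual_norm V N (\<lambda>f. f z))"
      if f: "f \<in> closed_unit_ball V N" and z: "z \<in> K" for f z
    proof -
      have "z \<in> G"
        using K z by blast
      from cSUP_upper[OF f bdd[OF this]]
      have "cmod (f z) \<le> dual_norm V N (\<lambda>f. f z)"
        by (simp add: dual_norm_def)
      also have "\<dots> \<le> (SUP z\<in>K. dual_norm V N (\<lambda>f. f z))"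
        by (rule cSUP_upper[OF z bK])
      finally show ?thesis .
    qed
    then show "\<exists>c. \<forall>f\<in>closed_unit_ball V N. \<forall>z\<in>K. cmod (f z) \<le> c"
      by blast
  qed
qed

section \<open>Completeness of weighted spaces\<close>

lemma v_norm_upper:
  assumes "f \<in> Hv_space G v" "z \<in> G"
  shows "v z * cmod (f z) \<le> v_norm G v f"
  using cSUP_upper[OF assms(2), of "\<lambda>z. v z * cmod (f z)"] assms(1)
  by (simp add: Hv_space_def v_norm_def)

lemma Hv_space_v_norm_leI:
  assumes "G \<noteq> {}" "f \<in> hol_space G" "\<And>z. z \<in> G \<Longrightarrow> v z * cmod (f z) \<le> c"
  shows "f \<in> Hv_space G v" "v_norm G v f \<le> c"
  using assms(2) bdd_aboveI2[of G "\<lambda>z. v z * cmod (f z)" c, OF assms(3)]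
    cSUP_least[OF assms(1), of "\<lambda>z. v z * cmod (f z)" c, OF assms(3)]
  by (simp_all add: Hv_space_def v_norm_def)

text \<open>
  The estimate produces a holomorphic pointwise limit \<open>g\<close>.  Letting \<open>m\<close> tend to infinity in
  \<open>v z * \<bar>\<sigma> n z - \<sigma> m z\<bar> \<le> e\<close> for fixed \<open>z\<close> shows both that \<open>g\<close> belongs to the space and that the
  convergence holds in norm.
\<close>
lemma Hv_space_complete:
  assumes G: "open G" "G \<noteq> {}"
    and nrm: "is_norm_on (Hv_space G v) (v_norm G v)"
    and B: "evaluations_locally_bounded G (Hv_space G v) (v_norm G v)"
  shows "is_Banach_space (Hv_space G v) (v_norm G v)"
proof -
  define H where "H = Hv_space G v"
  define N where "N = v_norm G v"
  have V: "is_norm_on H N" and B: "evaluations_locally_bounded G H N"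
    using nrm B by (simp_all add: H_def N_def)
  interpret Metric_space H "norm_dist H N"
    using V by (rule Metric_space_norm_dist)
  have HG: "f \<in> hol_space G" if "f \<in> H" for f
    using that by (simp add: H_def Hv_space_def)
  have Hdiff: "f - g \<in> H" if "f \<in> H" "g \<in> H" for f g
    using cfun.subspace_diff[OF is_norm_onD(1)[OF V] that] .
  have "mcomplete"
    unfolding mcomplete_def
  proof (intro allI impI)
    fix \<sigma> assume "MCauchy \<sigma>"
    then have \<sigma>: "\<sigma> n \<in> H" for n
      by (auto simp: MCauchy_def)
    have Cau: "\<exists>M. \<forall>m\<ge>M. \<forall>n\<ge>M. N (\<sigma> m - \<sigma> n) < e" if e: "0 < e" for e
    proof -
      obtain M where "\<forall>n n'. M \<le> n \<longrightarrow> M \<le> n' \<longrightarrow> norm_dist H N (\<sigma> n) (\<sigma> n') < e"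
        using \<open>MCauchy \<sigma>\<close> e unfolding MCauchy_def by blast
      then have "\<forall>m\<ge>M. \<forall>n\<ge>M. N (\<sigma> m - \<sigma> n) < e"
        using \<sigma> by (simp add: norm_dist_def)
      then show ?thesis ..
    qed
    have uC: "uniformly_Cauchy_on K \<sigma>" if K: "compact K" "K \<subseteq> G" for K
    proof -
      obtain C where C: "0 < C" "\<forall>f\<in>H. \<forall>z\<in>K. cmod (f z) \<le> C * N f"
        by (rule evaluations_locally_boundedE[OF B V K])
      show ?thesis
        unfolding uniformly_Cauchy_on_def
      proof (intro allI impI)
        fix e :: real assume e: "0 < e"
        then obtain M where M: "\<And>m n. m \<ge> M \<Longrightarrow> n \<ge> M \<Longrightarrow> N (\<sigma> m - \<sigma> n) < e / C"
          using Cau[of "e / C"] C(1) by auto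
        have "dist (\<sigma> m z) (\<sigma> n z) < e" if "z \<in> K" "m \<ge> M" "n \<ge> M" for z m n
        proof -
          have "dist (\<sigma> m z) (\<sigma> n z) \<le> C * N (\<sigma> m - \<sigma> n)"
            using C(2)[rule_format, OF Hdiff[OF \<sigma> \<sigma>] that(1)] by (simp add: dist_norm)
          also have "\<dots> < e"
            using M[OF that(2,3)] C(1) by (simp add: field_simps)
          finally show ?thesis .
        qed
        then show "\<exists>M. \<forall>z\<in>K. \<forall>m\<ge>M. \<forall>n\<ge>M. dist (\<sigma> m z) (\<sigma> n z) < e"
          by blast
      qed
    qed
    define g where "g z = lim (\<lambda>n. \<sigma> n z)" for z
    have ul: "uniform_limit K \<sigma> g sequentially" if K: "compact K" "K \<subseteq> G" for K
    proof -
      obtain l where l: "uniform_limit K \<sigma> l sequentially"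
        using Cauchy_uniformly_convergent[OF uC[OF K]] unfolding uniformly_convergent_on_def by blast
      have "l z = g z" if "z \<in> K" for z
        using tendsto_uniform_limitI[OF l that] by (simp add: g_def limI)
      then show ?thesis
        using uniform_limit_cong'[of K \<sigma> \<sigma> l g sequentially] l by simp
    qed
    have gG: "g \<in> hol_space G"
    proof (rule hol_space_uniform_limit[OF G(1) HG[OF \<sigma>]])
      show "g z = 0" if "z \<notin> G" for z
        using HG[OF \<sigma>] that by (simp add: g_def hol_space_def limI)
      show "\<exists>d>0. cball z d \<subseteq> G \<and> uniform_limit (cball z d) \<sigma> g sequentially" if "z \<in> G" for z
        using open_contains_cball[of G] G(1) that ul by (meson compact_cball)
    qed
    have lim: "(\<lambda>n. \<sigma> n z) \<longlonglongrightarrow> g z" if "z \<in> G" for z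
      using tendsto_uniform_limitI[OF ul[of "{z}"]] that by simp
    have tail: "\<exists>M. \<forall>n\<ge>M. \<sigma> n - g \<in> H \<and> N (\<sigma> n - g) \<le> e" if e: "0 < e" for e
    proof -
      obtain M where M: "\<And>m n. m \<ge> M \<Longrightarrow> n \<ge> M \<Longrightarrow> N (\<sigma> m - \<sigma> n) < e"
        using Cau[OF e] by blast
      have "v z * cmod ((\<sigma> n - g) z) \<le> e" if n: "n \<ge> M" and z: "z \<in> G" for n z
      proof (rule tendsto_upperbound)
        show "(\<lambda>m. v z * cmod (\<sigma> n z - \<sigma> m z)) \<longlonglongrightarrow> v z * cmod ((\<sigma> n - g) z)"
          by (auto intro!: tendsto_intros lim z)
        show "\<forall>\<^sub>F m in sequentially. v z * cmod (\<sigma> n z - \<sigma> m z) \<le> e"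
          using eventually_ge_at_top[of M]
        proof eventually_elim
          case (elim m)
          have "v z * cmod ((\<sigma> n - \<sigma> m) z) \<le> N (\<sigma> n - \<sigma> m)"
            unfolding N_def by (rule v_norm_upper[OF Hdiff[OF \<sigma> \<sigma>, unfolded H_def] z])
          then show ?case
            using M[OF n elim] by simp
        qed
      qed simp
      then show ?thesis
        using Hv_space_v_norm_leI[OF G(2) hol_space_diff[OF HG[OF \<sigma>] gG]]
        unfolding H_def N_def by blast
    qed
    obtain M where "\<sigma> M - g \<in> H"
      using tail[of 1] by auto
    then have gH: "g \<in> H"
      using Hdiff[OF \<sigma>[of M], of "\<sigma> M - g"] by simp
    have "limitin mtopology \<sigma> g sequentially"
      unfolding limit_metric_sequentially
    proof (intro conjI allI impI)
      fix e :: real assume "0 < e"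
      then obtain M where "\<forall>n\<ge>M. \<sigma> n - g \<in> H \<and> N (\<sigma> n - g) \<le> e / 2"
        using tail[of "e / 2"] by auto
      then show "\<exists>M. \<forall>n\<ge>M. \<sigma> n \<in> H \<and> norm_dist H N (\<sigma> n) g < e"
        using \<open>0 < e\<close> \<sigma> gH by (intro exI[of _ M]) (force simp: norm_dist_def)
    qed (rule gH)
    then show "\<exists>x. limitin mtopology \<sigma> x sequentially"
      by (intro exI[of _ g])
  qed
  then show ?thesis
    using V by (simp add: is_Banach_space_def H_def N_def)
qed

lemma cmod_le_SUP_compact:
  assumes "f \<in> hol_space G" "compact K" "K \<subseteq> G" "z \<in> K"
  shows "cmod (f z) \<le> (SUP z\<in>K. cmod (f z))"
proof -
  have "continuous_on K (\<lambda>z. cmod (f z))"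
    using assms by (intro continuous_on_norm hol_space_continuous_on)
  then have "bdd_above ((\<lambda>z. cmod (f z)) ` K)"
    using assms(2) by (intro bounded_imp_bdd_above compact_imp_bounded compact_continuous_image)
  then show ?thesis
    using assms(4) by (rule cSUP_upper[rotated])
qed

text \<open>
  The closed graph property of the inclusion, in the form needed for \<open>Banach_seminorms_bounded\<close>.  Summability over
  every \<open>D i\<close> makes the series converge locally uniformly to a holomorphic \<open>g\<close>, while its norm limit is \<open>f\<close>.
  The two agree where \<open>v > 0\<close>; thus \<open>v * \<bar>f - g\<bar>\<close> vanishes on \<open>G\<close>, and definiteness of the norm
  forces \<open>f = g\<close> on all of \<open>G\<close>.
\<close>
lemma Hv_space_countably_subadditive:
  assumes G: "open G" "G \<noteq> {}"
    and nrm: "is_norm_on (Hv_space G v) (v_norm G v)"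
    and D: "\<And>n. compact (D n)" "\<And>n. D n \<subseteq> G" "\<And>n. D n \<noteq> {}"
    and exh: "\<And>K. compact K \<Longrightarrow> K \<subseteq> G \<Longrightarrow> \<exists>n. K \<subseteq> D n"
    and u: "range u \<subseteq> Hv_space G v" and f: "f \<in> Hv_space G v"
    and conv: "(\<lambda>n. v_norm G v (f - (\<Sum>k<n. u k))) \<longlonglongrightarrow> 0"
    and summ: "\<And>i. summable (\<lambda>k. SUP z\<in>D i. cmod (u k z))"
  shows "(SUP z\<in>D j. cmod (f z)) \<le> (\<Sum>k. SUP z\<in>D j. cmod (u k z))"
proof -
  note sub = is_norm_onD(1)[OF nrm]
  have uH: "u k \<in> Hv_space G v" and uG: "u k \<in> hol_space G" and fG: "f \<in> hol_space G" for k
    using subsetD[OF u rangeI] f by (simp_all add: Hv_space_def)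
  have up: "cmod (u k z) \<le> (SUP z\<in>D i. cmod (u k z))" if "z \<in> D i" for i k z
    by (rule cmod_le_SUP_compact[OF uG D(1,2) that])
  define s where "s n = (\<Sum>k<n. u k)" for n
  have s_app: "s n z = (\<Sum>k<n. u k z)" for n z
    by (induction n) (simp_all add: s_def)
  have sH: "s n \<in> Hv_space G v" for n
    unfolding s_def using uH by (intro cfun.subspace_sum[OF sub])
  then have sG: "s n \<in> hol_space G" for n
    by (simp add: Hv_space_def)
  define g where "g z = (\<Sum>k. u k z)" for z
  have ul: "uniform_limit (D i) s g sequentially" for i
    unfolding s_app[abs_def] g_def by (rule Weierstrass_m_test[OF up summ])
  have gG: "g \<in> hol_space G"
  proof (rule hol_space_uniform_limit[OF G(1) sG])
    show "g z = 0" if "z \<notin> G" for z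
      using uG that by (simp add: g_def hol_space_def)
    fix z assume "z \<in> G"
    then obtain d where d: "0 < d" "cball z d \<subseteq> G"
      using G(1) open_contains_cball by blast
    obtain i where "cball z d \<subseteq> D i"
      using exh[OF compact_cball d(2)] by blast
    then show "\<exists>d>0. cball z d \<subseteq> G \<and> uniform_limit (cball z d) s g sequentially"
      using d uniform_limit_on_subset[OF ul] by blast
  qed
  have slim: "(\<lambda>n. s n z) \<longlonglongrightarrow> g z" if "z \<in> G" for z
  proof -
    have "\<exists>i. {z} \<subseteq> D i"
      using that by (intro exh) auto
    then obtain i where "z \<in> D i"
      by blast
    with ul show ?thesis
      by (rule tendsto_uniform_limitI)
  qed
  have zero: "v z * cmod ((f - g) z) \<le> 0" if z: "z \<in> G" for z
  proof (rule tendsto_le[OF _ conv[folded s_def]])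
    show "(\<lambda>n. v z * cmod (f z - s n z)) \<longlonglongrightarrow> v z * cmod ((f - g) z)"
      by (auto intro!: tendsto_intros slim z)
    show "\<forall>\<^sub>F n in sequentially. v z * cmod (f z - s n z) \<le> v_norm G v (f - s n)"
      using v_norm_upper[OF cfun.subspace_diff[OF sub f sH] z] by simp
  qed simp
  have fg: "f - g \<in> Hv_space G v" "v_norm G v (f - g) \<le> 0"
    by (rule Hv_space_v_norm_leI[OF G(2) hol_space_diff[OF fG gG] zero], assumption)+
  then have "f - g = 0"
    using is_norm_onD(2,3)[OF nrm fg(1)] by simp
  then have "f = g"
    by simp
  show ?thesis
  proof (rule cSUP_least[OF D(3)])
    fix z assume z: "z \<in> D j"
    have "summable (\<lambda>k. cmod (u k z))"
      by (rule summable_comparison_test'[OF summ[of j], of 0]) (use up[OF z] in simp)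
    then have "cmod (\<Sum>k. u k z) \<le> (\<Sum>k. cmod (u k z))"
      and "(\<Sum>k. cmod (u k z)) \<le> (\<Sum>k. SUP z\<in>D j. cmod (u k z))"
      by (rule summable_norm, intro suminf_le up[OF z] summ)
    then show "cmod (f z) \<le> (\<Sum>k. SUP z\<in>D j. cmod (u k z))"
      unfolding \<open>f = g\<close> g_def by (rule order_trans)
  qed
qed

text \<open>
  The suprema over a compact exhaustion of \<open>G\<close> are increasing seminorms that are countably subadditive
  by the previous lemma, hence bounded by multiples of the norm.
\<close>
lemma Hv_space_Banach_imp_evaluations_locally_bounded:
  assumes G: "open G" "G \<noteq> {}"
    and Ban: "is_Banach_space (Hv_space G v) (v_norm G v)"
  shows "evaluations_locally_bounded G (Hv_space G v) (v_norm G v)"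
proof -
  have nrm: "is_norm_on (Hv_space G v) (v_norm G v)"
    using Ban by (simp add: is_Banach_space_def)
  obtain a where a: "a \<in> G"
    using G(2) by blast
  obtain E where E: "\<And>n. compact (E n)" "\<And>n. E n \<subseteq> G" "\<And>n. E n \<subseteq> interior (E (Suc n))"
    "\<And>K. compact K \<Longrightarrow> K \<subseteq> G \<Longrightarrow> \<exists>M. \<forall>n\<ge>M. K \<subseteq> E n"
    using open_Union_compact_subsets[OF G(1)] by metis
  \<comment> \<open>Adding a point keeps the sets nonempty, so that the suprema over them are meaningful.\<close>
  define D where "D n = insert a (E n)" for n
  have D: "compact (D n)" "D n \<subseteq> G" "D n \<noteq> {}" for n
    using E(1,2) a by (auto simp: D_def)
  have "E n \<subseteq> E (Suc n)" for n
    using E(3) interior_subset by blast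
  then have mono: "D i \<subseteq> D j" if "i \<le> j" for i j
    using lift_Suc_mono_le[of E i j] that by (auto simp: D_def)
  have exh: "\<exists>n. K \<subseteq> D n" if "compact K" "K \<subseteq> G" for K
    using E(4)[OF that] by (auto simp: D_def)
  define p where "p n f = (SUP z\<in>D n. cmod (f z))" for n :: nat and f :: "complex \<Rightarrow> complex"
  have up: "cmod (f z) \<le> p n f" if "f \<in> Hv_space G v" "z \<in> D n" for f n z
    unfolding p_def using that by (intro cmod_le_SUP_compact[OF _ D(1,2)]) (auto simp: Hv_space_def)
  have least: "p n f \<le> c" if "\<And>z. z \<in> D n \<Longrightarrow> cmod (f z) \<le> c" for f n c
    unfolding p_def using that by (rule cSUP_least[OF D(3)])
  have nonneg: "0 \<le> p n f" if "f \<in> Hv_space G v" for n f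
    using up[OF that, of a n] by (auto simp: D_def intro: order_trans[OF norm_ge_zero])
  have scale_le: "p n (fscale c f) \<le> cmod c * p n f" if "f \<in> Hv_space G v" for n c f
    by (rule least) (auto simp: fscale_def norm_mult intro!: mult_left_mono up that)
  have bounded: "\<exists>C. \<forall>f\<in>Hv_space G v. p n f \<le> C * v_norm G v f" for n
  proof (rule Banach_seminorms_bounded[OF Ban])
    show "p n (fscale c f) = cmod c * p n f" if f: "f \<in> Hv_space G v" for n c f
    proof (rule antisym[OF scale_le[OF f]])
      have cf: "fscale c f \<in> Hv_space G v"
        by (rule cfun.subspace_scale[OF is_norm_onD(1)[OF nrm] f])
      show "cmod c * p n f \<le> p n (fscale c f)"
      proof (cases "c = 0")
        case False
        have "fscale (inverse c) (fscale c f) = f"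
          using False by (simp add: fscale_def fun_eq_iff)
        then have "p n f \<le> cmod (inverse c) * p n (fscale c f)"
          using scale_le[OF cf, of n "inverse c"] by simp
        then show ?thesis
          using False by (simp add: norm_divide field_simps)
      qed (use nonneg[OF cf] in simp)
    qed
    show "p n (f + g) \<le> p n f + p n g" if "f \<in> Hv_space G v" "g \<in> Hv_space G v" for n f g
      by (rule least) (auto intro!: order_trans[OF norm_triangle_ineq] add_mono up that)
    show "p i f \<le> p j f" if "i \<le> j" "f \<in> Hv_space G v" for i j f
      by (rule least) (use mono[OF that(1)] up[OF that(2)] in blast)
    show "p j f \<le> (\<Sum>k. p j (u k))"
      if "range u \<subseteq> Hv_space G v" "f \<in> Hv_space G v"
        "(\<lambda>n. v_norm G v (f - (\<Sum>k<n. u k))) \<longlonglongrightarrow> 0" "\<And>i. summable (\<lambda>k. p i (u k))" for j u f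
      using Hv_space_countably_subadditive[OF G nrm D exh that(1-3) that(4)[unfolded p_def]]
      by (simp add: p_def)
  qed (rule nonneg)
  show ?thesis
    unfolding evaluations_locally_bounded_def
  proof (intro allI impI)
    fix K assume "compact K \<and> K \<subseteq> G"
    then obtain n where n: "K \<subseteq> D n"
      using exh by blast
    obtain C where "\<And>f. f \<in> Hv_space G v \<Longrightarrow> p n f \<le> C * v_norm G v f"
      using bounded by blast
    then show "\<exists>C. \<forall>f\<in>Hv_space G v. \<forall>z\<in>K. cmod (f z) \<le> C * v_norm G v f"
      using n up by (meson order_trans subsetD)
  qed
qed

theorem proposition2p4:
  fixes G :: "complex set" and v :: "complex \<Rightarrow> real"
  assumes "open G" and "connected G" and "G \<noteq> {}"
    and "\<And>z. z \<in> G \<Longrightarrow> 0 \<le> v z"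
    and "is_norm_on (Hv_space G v) (v_norm G v)"
  shows "let H = Hv_space G v; N = v_norm G v;
      i = is_Banach_space H N;
      ii = continuous_map (norm_topology H N) (tau_co G) (\<lambda>f. f);
      ii' = (\<forall>\<sigma>::nat \<Rightarrow> complex \<Rightarrow> complex.
        range \<sigma> \<subseteq> H \<and> (\<exists>C. \<forall>n. N (\<sigma> n) \<le> C) \<longrightarrow> normal_family G (range \<sigma>));
      iii = tvs_bounded (tau_co G) (closed_unit_ball H N);
      iv = ((\<forall>z\<in>G. (\<lambda>f. f z) \<in> dual_space H N) \<and>
        (\<forall>K. compact K \<and> K \<subseteq> G \<longrightarrow> bdd_above ((\<lambda>z. dual_norm H N (\<lambda>f. f z)) ` K)))
    in (i \<longleftrightarrow> ii) \<and> (ii \<longleftrightarrow> ii') \<and> (ii \<longleftrightarrow> iii) \<and> (iii \<longleftrightarrow> iv)"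
proof -
  have VG: "Hv_space G v \<subseteq> hol_space G"
    by (auto simp: Hv_space_def)
  have "is_Banach_space (Hv_space G v) (v_norm G v) \<longleftrightarrow>
      evaluations_locally_bounded G (Hv_space G v) (v_norm G v)"
    using Hv_space_Banach_imp_evaluations_locally_bounded Hv_space_complete assms by blast
  then show ?thesis
    unfolding Let_def
    using evaluations_locally_bounded_iff_inclusion_continuous[OF assms(5) VG]
      evaluations_locally_bounded_iff_normal_family[OF assms(1,5) VG]
      evaluations_locally_bounded_iff_tvs_bounded[OF assms(5) VG]
      evaluations_locally_bounded_iff_dual_norm[OF assms(5), of G]
    by simp
qed

end
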